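(* Let $\bar A\in\mathbb{R}^{m\times n}$ have full column rank, $D\in\mathbb{R}^{n\times m}$, $\bar b,a\in\mathbb{R}^n$, $c\in\mathbb{R}$, and let $\mathcal{Z}\subseteq\mathbb{R}^{m\times n}$ be a convex compact set of the form $$\mathcal{Z}=\left\{\Delta\in\mathbb{R}^{m\times n}:\ \mathrm{trace}(C^{i\,T}\Delta)+q^i=0,\ i=1,\dots,I;\ \ h_\ell(\Delta)\le 0,\ \ell=1,\dots,L;\ \ g_k(\Delta)\preceq 0_{p\times p},\ k=1,\dots,K\right\}$$ (with data as described in the context) which contains $0_{m\times n}$ as a Slater point. For $\Delta\in\mathcal{Z}$ let $A(\Delta)=\bar A+\Delta$ and $b(\Delta)=\bar b+D\Delta a$. Assume that $\bar A^T\bar A+2\Delta^T\bar A$ is positive semi-definite for all $\Delta\in\mathcal{Z}$. Then: (I) If $y\in\mathbb{R}^n$ satisfies $$y^TA(\Delta)^TA(\Delta)y+b(\Delta)^Ty+c\le 0\qquad\forall\Delta\in\mathcal{Z},$$ then there exists $W\in\mathbb{R}^{n\times n}$ such that $$\mathrm{trace}(\bar A^T\bar AW)+\delta^*_{\mathcal{Z}}(2\bar AW+D^Tya^T)+\bar b^Ty+c\le 0,\qquad \begin{bmatrix} W & y \\ y^T & 1 \end{bmatrix}\succeq 0_{(n+1)\times(n+1)}.$$ (II) If $y\in\mathbb{R}^n$ satisfies $$\sqrt{y^TA(\Delta)^TA(\Delta)y}+b(\Delta)^Ty+c\le 0\qquad\forall\Delta\in\mathcal{Z},$$ then there exist $W\in\mathbb{R}^{n\times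 n}$ and $\eta\in\mathbb{R}$ such that $$\mathrm{trace}(\bar A^T\bar AW)+\delta^*_{\mathcal{Z}}(2\bar AW+D^Tya^T)+\bar b^Ty+c+\frac{\eta}{4}\le 0,\qquad \begin{bmatrix} W & y \\ y^T & \eta \end{bmatrix}\succeq 0_{(n+1)\times(n+1)}.$$
   Context: Support function: for $\mathcal{Z}\subseteq\mathbb{R}^{m\times n}$ convex and $U\in\mathbb{R}^{m\times n}$, $\delta^*_{\mathcal{Z}}(U):=\sup_{\Delta\in\mathcal{Z}}\mathrm{trace}(\Delta U^T)$. Notation: $M\succeq N$ means that $M-N$ is symmetric and positive semi-definite; $M\succ N$ means that $M-N$ is symmetric positive definite ($\preceq,\prec$ are the reversed relations). A square, not necessarily symmetric, matrix $M$ is called positive semi-definite if $(M+M^T)/2\succeq 0$, i.e. $y^TMy\ge 0$ for all $y$. Data of $\mathcal{Z}$: $p$ is a positive integer, $C^i\in\mathbb{R}^{m\times n}$, $q^i\in\mathbb{R}$, $h_\ell:\mathbb{R}^{m\times n}\to\mathbb{R}$ are convex continuous functions, and $g_k:\mathbb{R}^{m\times n}\to\mathbb{R}^{p\times p}$ are continuous and convex (with respect to the order $\preceq$). A Slater point is $\bar\Delta\in\mathcal{Z}$ with $h_\ell(\bar\Delta)<0$ for all $\ell$ and $g_k(\bar\Delta)\prec 0_{p\times p}$ for all $k$. *)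

theory Defs
  imports "HOL-Analysis.Analysis"
begin

text \<open>
  An $m \times n$ matrix is an element of type \<open>real^'n^'m\<close>, with $m = CARD('m)$, $n = CARD('n)$.
\<close>

definition sym_psd :: "real^'n^'n \<Rightarrow> bool"
  where "sym_psd M \<longleftrightarrow> transpose M = M \<and> (\<forall>v. 0 \<le> v \<bullet> (M *v v))"

definition sym_pd :: "real^'n^'n \<Rightarrow> bool"
  where "sym_pd M \<longleftrightarrow> transpose M = M \<and> (\<forall>v. v \<noteq> 0 \<longrightarrow> 0 < v \<bullet> (M *v v))"

text \<open>The Loewner orders on all square matrices: comparable matrices differ by a symmetric one.\<close>

definition loewner_le :: "real^'n^'n \<Rightarrow> real^'n^'n \<Rightarrow> bool"  (infix "\<preceq>\<^sub>L" 50)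
  where "M \<preceq>\<^sub>L N \<longleftrightarrow> sym_psd (N - M)"

definition loewner_less :: "real^'n^'n \<Rightarrow> real^'n^'n \<Rightarrow> bool"  (infix "\<prec>\<^sub>L" 50)
  where "M \<prec>\<^sub>L N \<longleftrightarrow> sym_pd (N - M)"

text \<open>Positive semi-definiteness of a not necessarily symmetric matrix.\<close>

definition pos_semidef :: "real^'n^'n \<Rightarrow> bool"
  where "pos_semidef M \<longleftrightarrow> 0 \<preceq>\<^sub>L (1/2) *\<^sub>R (M + transpose M)"

definition loewner_convex :: "('a::real_vector \<Rightarrow> real^'p^'p) \<Rightarrow> bool"
  where "loewner_convex g \<longleftrightarrow>
    (\<forall>X Y t. 0 \<le> t \<and> t \<le> 1 \<longrightarrow>
      g ((1 - t) *\<^sub>R X + t *\<^sub>R Y) \<preceq>\<^sub>L (1 - t) *\<^sub>R g X + t *\<^sub>R g Y)"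

text \<open>
  The supremum is taken in the reals, so this is the support function only for nonempty bounded
  \<open>Z\<close>; for unbounded \<open>Z\<close> the true value may be infinite.
\<close>

definition support_fun :: "(real^'n^'m) set \<Rightarrow> real^'n^'m \<Rightarrow> real"
  where "support_fun Z U = (SUP \<Delta>\<in>Z. trace (\<Delta> ** transpose U))"

definition constraint_set ::
  "nat \<Rightarrow> (nat \<Rightarrow> real^'n^'m) \<Rightarrow> (nat \<Rightarrow> real) \<Rightarrow>
   nat \<Rightarrow> (nat \<Rightarrow> real^'n^'m \<Rightarrow> real) \<Rightarrow>
   nat \<Rightarrow> (nat \<Rightarrow> real^'n^'m \<Rightarrow> real^'p^'p) \<Rightarrow> (real^'n^'m) set"
  where "constraint_set I C q L h K g =
    {\<Delta>. (\<forall>i\<in>{1..I}. trace (transpose (C i) ** \<Delta>) + q i = 0) \<and>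
         (\<forall>l\<in>{1..L}. h l \<Delta> \<le> 0) \<and>
         (\<forall>k\<in>{1..K}. g k \<Delta> \<preceq>\<^sub>L 0)}"

definition slater_point ::
  "nat \<Rightarrow> (nat \<Rightarrow> real^'n^'m) \<Rightarrow> (nat \<Rightarrow> real) \<Rightarrow>
   nat \<Rightarrow> (nat \<Rightarrow> real^'n^'m \<Rightarrow> real) \<Rightarrow>
   nat \<Rightarrow> (nat \<Rightarrow> real^'n^'m \<Rightarrow> real^'p^'p) \<Rightarrow> real^'n^'m \<Rightarrow> bool"
  where "slater_point I C q L h K g \<Delta> \<longleftrightarrow>
    \<Delta> \<in> constraint_set I C q L h K g \<and>
    (\<forall>l\<in>{1..L}. h l \<Delta> < 0) \<and> (\<forall>k\<in>{1..K}. g k \<Delta> \<prec>\<^sub>L 0)"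

text \<open>The bordered matrix with rows $(W, y)$ and $(y^T, \eta)$; the index \<open>Inr 1\<close> is the last one.\<close>

definition bordered :: "real^'n^'n \<Rightarrow> real^'n \<Rightarrow> real \<Rightarrow> real^('n + 1)^('n + 1)"
  where "bordered W y \<eta> =
    (\<chi> i j. case i of
        Inl r \<Rightarrow> (case j of Inl s \<Rightarrow> W $ r $ s | Inr _ \<Rightarrow> y $ r)
      | Inr _ \<Rightarrow> (case j of Inl s \<Rightarrow> y $ s | Inr _ \<Rightarrow> \<eta>))"

definition outer :: "real^'m \<Rightarrow> real^'n \<Rightarrow> real^'n^'m"
  where "outer u v = (columnvector u :: real^1^'m) ** rowvector v"

end

theory Submission
  imports Defs
begin

text \<open>
  Write $s(\Delta) = \|\bar A y\|^2 + 2 (\bar A y)^T \Delta y$. It is affine in $\Delta$, bounded above by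
  $\|(\bar A + \Delta) y\|^2$, and nonnegative on \<open>Z\<close> by the semi-definiteness assumption.
  For (I) take $W = y y^T$. For (II) take $W = y y^T / \eta$, so that a single $\eta > 0$ with
  $s(\Delta)/\eta + \eta/4 + b(\Delta)^T y + c \le 0$ on \<open>Z\<close> is needed. Let $\Delta^*$ maximise the
  concave function $\sqrt{s(\Delta)} + b(\Delta)^T y + c$ over the compact set \<open>Z\<close>. As $s(0) > 0$
  for $y \neq 0$, the infinite slope of the square root at 0 forces $s(\Delta^*) > 0$, and
  the first-order optimality condition at $\Delta^*$ says that $\eta = 2 \sqrt{s(\Delta^*)}$ works.
\<close>

section \<open>Outer products, traces and quadratic forms\<close>

lemma outer_component [simp]: "outer u v $ i $ j = u $ i * v $ j"
  by (simp add: outer_def matrix_matrix_mult_def columnvector_def rowvector_def)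

lemma transpose_outer: "transpose (outer u v) = outer v u"
  by (simp add: vec_eq_iff transpose_def mult.commute)

lemma matrix_mul_outer: "M ** outer u v = outer (M *v u) v"
  by (simp add: vec_eq_iff matrix_matrix_mult_def matrix_vector_mult_def sum_distrib_right
      mult.assoc)

lemma matrix_mul_scaleR:
  fixes M :: "real^'n^'m" and N :: "real^'k^'n"
  shows "M ** (r *\<^sub>R N) = r *\<^sub>R (M ** N)"
  by (simp add: vec_eq_iff matrix_matrix_mult_def sum_distrib_left mult_ac)

lemma trace_outer: "trace (outer u v) = u \<bullet> v"
  by (simp add: trace_def inner_vec_def)

lemma transpose_add: "transpose (M + N :: real^'n^'m) = transpose M + transpose N"
  by (simp add: vec_eq_iff transpose_def)

lemma transpose_scaleR: "transpose (r *\<^sub>R (M :: real^'n^'m)) = r *\<^sub>R transpose M"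
  by (simp add: vec_eq_iff transpose_def)

lemma trace_scaleR: "trace (r *\<^sub>R (M :: real^'n^'n)) = r * trace M"
  by (simp add: trace_def sum_distrib_left)

lemma inner_vector_matrix_mult:
  fixes M :: "real^'n^'m"
  shows "u \<bullet> (w v* M) = (M *v u) \<bullet> w"
  by (metis dot_lmul_matrix inner_commute)

lemma inner_gram_mult_vector:
  fixes M N :: "real^'n^'m"
  shows "u \<bullet> ((transpose M ** N) *v v) = (M *v u) \<bullet> (N *v v)"
  by (simp add: matrix_vector_mul_assoc [symmetric] inner_vector_matrix_mult)

text \<open>A matrix and its transpose have the same quadratic form, so passing to the symmetric
  part does not change it.\<close>

lemma pos_semidef_quadratic_form:
  fixes M :: "real^'n^'n"
  assumes "pos_semidef M"
  shows "0 \<le> v \<bullet> (M *v v)"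
proof -
  have "0 \<le> v \<bullet> (((1/2) *\<^sub>R (M + transpose M)) *v v)"
    using assms by (simp add: pos_semidef_def loewner_le_def sym_psd_def)
  also have "\<dots> = v \<bullet> (M *v v)"
    by (simp add: scaleR_matrix_vector_assoc [symmetric] matrix_vector_mult_add_rdistrib
        inner_add_right inner_vector_matrix_mult inner_commute)
  finally show ?thesis .
qed

section \<open>Semi-definiteness of the bordered matrix\<close>

lemma sum_over_sum_type:
  fixes f :: "'a::finite + 'b::finite \<Rightarrow> 'c::comm_monoid_add"
  shows "(\<Sum>x\<in>UNIV. f x) = (\<Sum>i\<in>UNIV. f (Inl i)) + (\<Sum>j\<in>UNIV. f (Inr j))"
  by (simp add: UNIV_Plus_UNIV [symmetric] sum.Plus del: UNIV_Plus_UNIV)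

lemma bordered_quadratic_form:
  fixes W :: "real^'n^'n" and v :: "real^('n + 1)"
  defines "u \<equiv> (\<chi> i. v $ Inl i)" and "t \<equiv> v $ Inr 1"
  shows "v \<bullet> (bordered W y \<eta> *v v) = u \<bullet> (W *v u) + 2 * t * (u \<bullet> y) + \<eta> * t\<^sup>2"
  unfolding u_def t_def
  by (simp add: inner_vec_def matrix_vector_mult_def bordered_def sum_over_sum_type
      sum.distrib sum_distrib_left algebra_simps power2_eq_square)

text \<open>With \<open>W\<close> equal to \<open>outer y y\<close> divided by \<open>\<eta>\<close>
  the Schur complement vanishes, so completing the square leaves a single square over
  \<open>\<eta>\<close>. For \<open>\<eta> = 0\<close> and \<open>y = 0\<close> the convention
  \<open>1 / 0 = 0\<close> turns the bordered matrix into the zero matrix.\<close>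

lemma sym_psd_bordered_outer:
  assumes "\<eta> > 0 \<or> \<eta> = 0 \<and> y = 0"
  shows "0 \<preceq>\<^sub>L bordered ((1 / \<eta>) *\<^sub>R outer y y) y \<eta>"
proof -
  have "0 \<le> v \<bullet> (bordered ((1 / \<eta>) *\<^sub>R outer y y) y \<eta> *v v)" for v
  proof -
    define u where "u = (\<chi> i. v $ Inl i)"
    define t where "t = v $ Inr 1"
    have "outer y y *v u = (u \<bullet> y) *\<^sub>R y"
      by (simp add: vec_eq_iff matrix_vector_mult_def inner_vec_def sum_distrib_left
          mult_ac)
    then have "v \<bullet> (bordered ((1 / \<eta>) *\<^sub>R outer y y) y \<eta> *v v)
        = (u \<bullet> y)\<^sup>2 / \<eta> + 2 * t * (u \<bullet> y) + \<eta> * t\<^sup>2"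
      by (simp add: bordered_quadratic_form u_def t_def scaleR_matrix_vector_assoc [symmetric]
          power2_eq_square)
    also have "\<dots> = (u \<bullet> y + \<eta> * t)\<^sup>2 / \<eta>"
      using assms by (auto simp: field_simps power2_eq_square)
    also have "\<dots> \<ge> 0"
      using assms by auto
    finally show ?thesis .
  qed
  moreover have "transpose (bordered ((1 / \<eta>) *\<^sub>R outer y y) y \<eta>)
      = bordered ((1 / \<eta>) *\<^sub>R outer y y) y \<eta>"
    by (simp add: vec_eq_iff transpose_def bordered_def mult.commute split: sum.split)
  ultimately show ?thesis
    by (simp add: loewner_le_def sym_psd_def)
qed

section \<open>Replacing the square root by one affine bound\<close>

text \<open>
  The pointwise bound \<open>sqrt (s x) \<le> s x / \<eta> + \<eta> / 4\<close> is tight at \<open>\<eta> = 2 * sqrt (s x)\<close>; the lemma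
  exchanges the supremum over \<open>x\<close> with the infimum over \<open>\<eta>\<close>.
\<close>

lemma uniform_sqrt_linearisation:
  fixes s f :: "'a::real_normed_vector \<Rightarrow> real"
  assumes "compact Z" "convex Z"
    and s_cont: "continuous_on Z s" and f_cont: "continuous_on Z f"
    and s_affine: "\<And>x y t. s ((1 - t) *\<^sub>R x + t *\<^sub>R y) = (1 - t) * s x + t * s y"
    and f_affine: "\<And>x y t. f ((1 - t) *\<^sub>R x + t *\<^sub>R y) = (1 - t) * f x + t * f y"
    and s_nonneg: "\<And>x. x \<in> Z \<Longrightarrow> 0 \<le> s x"
    and z: "z \<in> Z" "0 < s z"
    and bound: "\<And>x. x \<in> Z \<Longrightarrow> sqrt (s x) + f x \<le> 0"
  obtains \<eta> where "\<eta> > 0" "\<And>x. x \<in> Z \<Longrightarrow> s x / \<eta> + \<eta> / 4 + f x \<le> 0"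
proof -
  have "continuous_on Z (\<lambda>x. sqrt (s x) + f x)"
    by (intro continuous_intros s_cont f_cont)
  then obtain x0 where x0: "x0 \<in> Z"
    and max: "\<And>x. x \<in> Z \<Longrightarrow> sqrt (s x) + f x \<le> sqrt (s x0) + f x0"
    using continuous_attains_sup [OF \<open>compact Z\<close>, of "\<lambda>x. sqrt (s x) + f x"] z by blast
  define r where "r = sqrt (s x0)"
  have r: "r \<ge> 0" "s x0 = r\<^sup>2"
    using s_nonneg [OF x0] by (auto simp: r_def)
  \<comment> \<open>The optimality condition at \<open>x0\<close>, multiplied by
    \<open>2 * r\<close>: squaring before taking the limit avoids differentiating the square root at
    \<open>s x0\<close>, which might still be 0 here.\<close>
  have first_order: "s x - s x0 \<le> 2 * r * (f x0 - f x)" if x: "x \<in> Z" for x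
  proof -
    define d where "d = s x - s x0"
    define e where "e = f x0 - f x"
    have le: "d \<le> 2 * r * e + t * e\<^sup>2" if t: "0 < t" "t \<le> 1" for t
    proof -
      define w where "w = (1 - t) *\<^sub>R x0 + t *\<^sub>R x"
      have w: "w \<in> Z"
        using \<open>convex Z\<close> x0 x t unfolding w_def by (intro convexD) auto
      have sw: "s w = s x0 + t * d" and fw: "f w = f x0 - t * e"
        unfolding w_def s_affine f_affine d_def e_def by algebra+
      have "sqrt (s w) \<le> r + t * e"
        using max [OF w] fw by (simp add: r_def)
      then have "s w \<le> (r + t * e)\<^sup>2"
        by (rule sqrt_le_D)
      \<comment> \<open>The constant terms \<open>s x0\<close> and \<open>r\<^sup>2\<close> cancel,
        so a factor \<open>t\<close> can be divided out.\<close>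
      then have "t * d \<le> t * (2 * r * e + t * e\<^sup>2)"
        using sw r by (simp add: power2_eq_square algebra_simps)
      then show ?thesis
        using t by simp
    qed
    have "((\<lambda>t. 2 * r * e + t * e\<^sup>2) \<longlongrightarrow> 2 * r * e + 0 * e\<^sup>2) (at_right 0)"
      by (intro tendsto_intros)
    moreover have "\<forall>\<^sub>F t in at_right 0. d \<le> 2 * r * e + t * e\<^sup>2"
      using eventually_at_right_real [of 0 1] by (rule eventually_mono) (auto intro: le)
    ultimately have "d \<le> 2 * r * e + 0 * e\<^sup>2"
      by (rule tendsto_lowerbound) simp
    then show ?thesis
      by (simp add: d_def e_def)
  qed
  \<comment> \<open>If \<open>r = 0\<close>, then \<open>s x0 = 0\<close> and
    \<open>first_order\<close> at \<open>z\<close> would give \<open>s z \<le> 0\<close>.\<close>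
  have "r > 0"
    using first_order [OF z(1)] z(2) r by (cases "r = 0") auto
  show ?thesis
  proof
    show "2 * r > 0"
      using \<open>r > 0\<close> by simp
    show "s x / (2 * r) + 2 * r / 4 + f x \<le> 0" if "x \<in> Z" for x
    proof -
      have "s x / (2 * r) \<le> r / 2 + (f x0 - f x)"
        using first_order [OF that] \<open>r > 0\<close> r(2) by (simp add: field_simps power2_eq_square)
      moreover have "r + f x0 \<le> 0"
        using bound [OF x0] by (simp add: r_def)
      ultimately show ?thesis
        by simp
    qed
  qed
qed

section \<open>From the robust inequalities to the support function\<close>

theorem theorem3:
  fixes Abar :: "real^'n^'m"
    and D :: "real^'m^'n"
    and bbar a :: "real^'n"
    and c :: real
    and Z :: "(real^'n^'m) set"
    and I L K :: nat
    and C :: "nat \<Rightarrow> real^'n^'m"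
    and q :: "nat \<Rightarrow> real"
    and h :: "nat \<Rightarrow> real^'n^'m \<Rightarrow> real"
    and g :: "nat \<Rightarrow> real^'n^'m \<Rightarrow> real^'p^'p"
    and A :: "real^'n^'m \<Rightarrow> real^'n^'m"
    and b :: "real^'n^'m \<Rightarrow> real^'n"
  assumes full_column_rank: "rank Abar = CARD('n)"
    and h_convex: "\<And>l. l \<in> {1..L} \<Longrightarrow> convex_on UNIV (h l)"
    and h_cont: "\<And>l. l \<in> {1..L} \<Longrightarrow> continuous_on UNIV (h l)"
    and g_convex: "\<And>k. k \<in> {1..K} \<Longrightarrow> loewner_convex (g k)"
    and g_cont: "\<And>k. k \<in> {1..K} \<Longrightarrow> continuous_on UNIV (g k)"
    and Z_def: "Z = constraint_set I C q L h K g"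
    and Z_convex: "convex Z"
    and Z_compact: "compact Z"
    and slater: "slater_point I C q L h K g 0"
    and A_def: "\<And>\<Delta>. \<Delta> \<in> Z \<Longrightarrow> A \<Delta> = Abar + \<Delta>"
    and b_def: "\<And>\<Delta>. \<Delta> \<in> Z \<Longrightarrow> b \<Delta> = bbar + (D ** \<Delta>) *v a"
    and psd: "\<And>\<Delta>. \<Delta> \<in> Z \<Longrightarrow>
      pos_semidef (transpose Abar ** Abar + 2 *\<^sub>R (transpose \<Delta> ** Abar))"
  shows
    "(\<forall>y :: real^'n.
        (\<forall>\<Delta>\<in>Z. y \<bullet> ((transpose (A \<Delta>) ** A \<Delta>) *v y) + b \<Delta> \<bullet> y + c \<le> 0) \<longrightarrow>
        (\<exists>W :: real^'n^'n.
           trace (transpose Abar ** Abar ** W)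
             + support_fun Z (2 *\<^sub>R (Abar ** W) + outer (transpose D *v y) a)
             + bbar \<bullet> y + c \<le> 0 \<and>
           0 \<preceq>\<^sub>L bordered W y 1)) \<and>
     (\<forall>y :: real^'n.
        (\<forall>\<Delta>\<in>Z. sqrt (y \<bullet> ((transpose (A \<Delta>) ** A \<Delta>) *v y)) + b \<Delta> \<bullet> y + c \<le> 0) \<longrightarrow>
        (\<exists>(W :: real^'n^'n) (\<eta> :: real).
           trace (transpose Abar ** Abar ** W)
             + support_fun Z (2 *\<^sub>R (Abar ** W) + outer (transpose D *v y) a)
             + bbar \<bullet> y + c + \<eta> / 4 \<le> 0 \<and>
           0 \<preceq>\<^sub>L bordered W y \<eta>))"
proof -
  define s where "s y \<Delta> = (Abar *v y) \<bullet> (Abar *v y) + 2 * ((Abar *v y) \<bullet> (\<Delta> *v y))" for y \<Delta>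
  define f where "f y \<Delta> = (bbar + (D ** \<Delta>) *v a) \<bullet> y + c" for y \<Delta>
  have "0 \<in> Z"
    using slater by (simp add: slater_point_def Z_def)
  have s_nonneg: "0 \<le> s y \<Delta>" if "\<Delta> \<in> Z" for y \<Delta>
    using pos_semidef_quadratic_form [OF psd [OF that], of y]
    by (simp add: s_def matrix_vector_mult_add_rdistrib inner_add_right
        scaleR_matrix_vector_assoc [symmetric] inner_gram_mult_vector inner_commute)
  \<comment> \<open>The gap between the two sides is the squared norm of
    \<open>\<Delta> *v y\<close>.\<close>
  have s_le: "s y \<Delta> \<le> y \<bullet> ((transpose (A \<Delta>) ** A \<Delta>) *v y)" if "\<Delta> \<in> Z" for y \<Delta>
    using that
    by (simp add: A_def s_def inner_gram_mult_vector matrix_vector_mult_add_rdistrib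
        inner_add_left inner_add_right inner_commute)
  have b_f: "b \<Delta> \<bullet> y + c = f y \<Delta>" if "\<Delta> \<in> Z" for y \<Delta>
    using that by (simp add: b_def f_def)
  \<comment> \<open>For \<open>W = r *\<^sub>R outer y y\<close> the trace is the part of
    \<open>r * s y \<Delta>\<close> that is constant in \<open>\<Delta>\<close>, and the support
    function is the supremum of the remaining part plus that of \<open>f y \<Delta>\<close>. A
    pointwise bound on \<open>Z\<close> thus becomes the dual inequality. (I) uses
    \<open>r = 1\<close> and \<open>\<kappa> = 0\<close>, (II) uses \<open>r = 1 / \<eta>\<close>
    and \<open>\<kappa> = \<eta> / 4\<close>.\<close>
  have dual_bound: "trace (transpose Abar ** Abar ** (r *\<^sub>R outer y y))
        + support_fun Z (2 *\<^sub>R (Abar ** (r *\<^sub>R outer y y)) + outer (transpose D *v y) a)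
        + bbar \<bullet> y + c + \<kappa> \<le> 0"
    if le: "\<And>\<Delta>. \<Delta> \<in> Z \<Longrightarrow> r * s y \<Delta> + \<kappa> + f y \<Delta> \<le> 0" for r y \<kappa>
  proof -
    let ?N = "(Abar *v y) \<bullet> (Abar *v y)"
    have tr: "trace (transpose Abar ** Abar ** (r *\<^sub>R outer y y)) = r * ?N"
      by (simp add: matrix_mul_scaleR matrix_mul_outer trace_scaleR trace_outer
          inner_gram_mult_vector [of y Abar Abar y, symmetric] inner_commute)
    have "support_fun Z (2 *\<^sub>R (Abar ** (r *\<^sub>R outer y y)) + outer (transpose D *v y) a)
        \<le> - (r * ?N + bbar \<bullet> y + c + \<kappa>)"
      unfolding support_fun_def
    proof (rule cSUP_least)
      show "Z \<noteq> {}"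
        using \<open>0 \<in> Z\<close> by blast
      fix \<Delta> assume "\<Delta> \<in> Z"
      have "trace (\<Delta> ** transpose (2 *\<^sub>R (Abar ** (r *\<^sub>R outer y y)) + outer (transpose D *v y) a))
          = trace (\<Delta> ** ((2 * r) *\<^sub>R outer y (Abar *v y) + outer a (transpose D *v y)))"
        by (simp add: matrix_mul_scaleR matrix_mul_outer transpose_add transpose_scaleR transpose_outer)
      also have "\<dots> = trace ((2 * r) *\<^sub>R outer (\<Delta> *v y) (Abar *v y)
            + outer (\<Delta> *v a) (transpose D *v y))"
        by (simp only: matrix_add_ldistrib matrix_mul_scaleR matrix_mul_outer)
      also have "\<dots> = 2 * r * ((Abar *v y) \<bullet> (\<Delta> *v y)) + ((D ** \<Delta>) *v a) \<bullet> y"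
        by (simp add: trace_add trace_scaleR trace_outer inner_vector_matrix_mult
            matrix_vector_mul_assoc inner_commute)
      also have "\<dots> \<le> - (r * ?N + bbar \<bullet> y + c + \<kappa>)"
        using le [OF \<open>\<Delta> \<in> Z\<close>] by (simp add: s_def f_def inner_add_left algebra_simps)
      finally show "trace (\<Delta> ** transpose (2 *\<^sub>R (Abar ** (r *\<^sub>R outer y y))
          + outer (transpose D *v y) a)) \<le> - (r * ?N + bbar \<bullet> y + c + \<kappa>)" .
    qed
    then show ?thesis
      using tr by simp
  qed
  have part1: "\<exists>W :: real^'n^'n.
      trace (transpose Abar ** Abar ** W)
        + support_fun Z (2 *\<^sub>R (Abar ** W) + outer (transpose D *v y) a)
        + bbar \<bullet> y + c \<le> 0 \<and> 0 \<preceq>\<^sub>L bordered W y 1"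
    if y: "\<forall>\<Delta>\<in>Z. y \<bullet> ((transpose (A \<Delta>) ** A \<Delta>) *v y) + b \<Delta> \<bullet> y + c \<le> 0" for y
  proof -
    have "1 * s y \<Delta> + 0 + f y \<Delta> \<le> 0" if "\<Delta> \<in> Z" for \<Delta>
      using bspec [OF y that] s_le [OF that, of y] b_f [OF that, of y] by linarith
    from dual_bound [OF this] show ?thesis
      \<comment> \<open>The factor 1 keeps the witness in the form that \<open>dual_bound\<close>
        produces.\<close>
      using sym_psd_bordered_outer [of 1 y] by (intro exI [of _ "1 *\<^sub>R outer y y"]) simp
  qed
  have part2: "\<exists>(W :: real^'n^'n) (\<eta> :: real).
      trace (transpose Abar ** Abar ** W)
        + support_fun Z (2 *\<^sub>R (Abar ** W) + outer (transpose D *v y) a)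
        + bbar \<bullet> y + c + \<eta> / 4 \<le> 0 \<and> 0 \<preceq>\<^sub>L bordered W y \<eta>"
    if y: "\<forall>\<Delta>\<in>Z. sqrt (y \<bullet> ((transpose (A \<Delta>) ** A \<Delta>) *v y)) + b \<Delta> \<bullet> y + c \<le> 0" for y
  proof -
    have bound: "sqrt (s y \<Delta>) + f y \<Delta> \<le> 0" if "\<Delta> \<in> Z" for \<Delta>
    proof -
      have "sqrt (s y \<Delta>) \<le> sqrt (y \<bullet> ((transpose (A \<Delta>) ** A \<Delta>) *v y))"
        using s_le [OF that] by simp
      then show ?thesis
        using bspec [OF y that] b_f [OF that, of y] by linarith
    qed
    obtain \<eta> where \<eta>: "\<eta> > 0 \<or> \<eta> = 0 \<and> y = 0"
      and le: "\<And>\<Delta>. \<Delta> \<in> Z \<Longrightarrow> (1 / \<eta>) * s y \<Delta> + \<eta> / 4 + f y \<Delta> \<le> 0"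
    proof (cases "y = 0")
      case True
      \<comment> \<open>Here \<open>s y\<close> vanishes identically, so \<open>bound\<close>
        reduces to \<open>f y \<Delta> \<le> 0\<close> and \<open>\<eta> = 0\<close> suffices,
        giving \<open>W = 0\<close>.\<close>
      then show ?thesis
        using bound by (intro that [of 0]) (auto simp: s_def)
    next
      case False
      \<comment> \<open>Full column rank makes the nominal point 0 of \<open>Z\<close> a point where
        \<open>s y\<close> is strictly positive, as the square root bound requires.\<close>
      have "inj ((*v) Abar)"
        using full_column_rank by (simp add: full_rank_injective)
      then have "Abar *v y \<noteq> 0"
        using False by (metis injD matrix_vector_mult_0_right)
      then have "0 < s y 0"
        by (simp add: s_def)
      \<comment> \<open>These are the parts of \<open>s y\<close> and \<open>f y\<close> that vary
        with \<open>\<Delta>\<close>; their linearity yields both the continuity and the affinity of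
        the two functions.\<close>
      have lin: "linear (\<lambda>\<Delta>. (Abar *v y) \<bullet> (\<Delta> *v y))" "linear (\<lambda>\<Delta>. ((D ** \<Delta>) *v a) \<bullet> y)"
        by (auto intro!: linearI simp: matrix_vector_mult_add_rdistrib inner_add_right
            inner_add_left matrix_vector_mul_assoc [symmetric] matrix_vector_right_distrib
            scaleR_matrix_vector_assoc [symmetric] matrix_vector_mult_scaleR)
      have "continuous_on Z (s y)" "continuous_on Z (f y)"
        unfolding s_def f_def inner_add_left
        by (intro continuous_intros linear_continuous_on lin
            linear_conv_bounded_linear [THEN iffD1])+
      moreover have "s y ((1 - t) *\<^sub>R X + t *\<^sub>R Y) = (1 - t) * s y X + t * s y Y"
        "f y ((1 - t) *\<^sub>R X + t *\<^sub>R Y) = (1 - t) * f y X + t * f y Y" for X Y t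
        unfolding s_def f_def inner_add_left lin [THEN linear_add] lin [THEN linear_scale]
          real_scaleR_def
        by algebra+
      ultimately obtain \<eta> where "\<eta> > 0" "\<And>\<Delta>. \<Delta> \<in> Z \<Longrightarrow> s y \<Delta> / \<eta> + \<eta> / 4 + f y \<Delta> \<le> 0"
        using uniform_sqrt_linearisation [OF Z_compact Z_convex, of "s y" "f y" 0]
          s_nonneg \<open>0 \<in> Z\<close> \<open>0 < s y 0\<close> bound by metis
      then show ?thesis
        by (intro that [of \<eta>]) auto
    qed
    show ?thesis
      using dual_bound [OF le] sym_psd_bordered_outer [OF \<eta>] by blast
  qed
  show ?thesis
    using part1 part2 by blast
qed

end
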